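(* Let $\mathbf{D}=(D;\wedge,\vee,\neg,!,0,1,\top)$ be a DFf-algebra, with $\bot:=\neg\top$, $\Diamond x:=x\vee\bot$ and $\Box x:=x\wedge\bot$. Then the map $\iota\colon\mathbf{D}\to\Diamond(\mathbf{D})\times\Box(\mathbf{D})$, $a\mapsto(\Diamond a,\Box a)$, witnesses an isomorphism between $\mathbf{D}$ and a DFf-twist-algebra over $\Diamond(\mathbf{D})$ and $\Box(\mathbf{D})$, where the twist construction is taken with respect to the embedding of De Morgan algebras $\rho\colon\Box(\mathbf{D})\to\Diamond(\mathbf{D})$, $\Box a\mapsto\Diamond{!}a$.
   Context: A De Morgan algebra is a bounded distributive lattice with a unary operation $\neg$ satisfying $\neg\neg a=a$ and $\neg(a\wedge b)=\neg a\vee\neg b$. A DFf-algebra is an algebra $(D;\wedge,\vee,\neg,!,0,1,\top)$ such that $(D;\wedge,\vee,\neg,0,1)$ is a bounded De Morgan lattice (i.e. a De Morgan algebra) and the unary operation $!$ and constant $\top$ satisfy, with $\bot:=\neg\top$, $\Diamond x:=x\vee\bot$, $\Box x:=x\wedge\bot$: (1) if $\top=1$ then $x=y$ for all $x,y\in D$; (2) $\top\wedge\neg\top=0$; (3) $\Box a=\Box b$ implies $\Diamond{!}a=\Diamond{!}b$; (4) $\Diamond a=\Diamond b$ and $\Box a=\Box b$ imply $a=b$; (5) $\Diamond{!}a=\Diamond{!}b$ implies $\Box a=\Box b$; (6) $\Diamond{!}(a\vee b)=\Diamond{!}a\wedge\Diamond{!}b$; (7) $\Diamond{!}\neg a=\Diamond\neg{!}a$;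 (8) $!\bot=0$ and $!0=\top$; (9) $\Box{!}a=0$. Set $\Diamond(\mathbf{D}):=(\Diamond[D];\wedge,\vee,\neg_\Diamond,\bot,1)$, where $\neg_\Diamond\Diamond a:=\Diamond\neg a$ (least element $\bot$, greatest element $1$). Set $\Box(\mathbf{D}):=(\Box[D];\wedge_\Box,\vee_\Box,\neg_\Box,0_\Box,1_\Box)$, where $\Box a\wedge_\Box\Box b:=\Box(a\vee b)$, $\Box a\vee_\Box\Box b:=\Box(a\wedge b)$, $\neg_\Box\Box a:=\Box\neg a$, $0_\Box:=\bot$, $1_\Box:=0$. Both are De Morgan algebras. For De Morgan algebras $\mathbf{D}_1,\mathbf{D}_2$ and an embedding $\rho\colon\mathbf{D}_2\hookrightarrow\mathbf{D}_1$ of De Morgan algebras, the full DFf-twist-algebra $\mathbf{D}_1\bowtie\mathbf{D}_2$ has universe $D_1\times D_2$ and operations $(x_1,x_2)\wedge(y_1,y_2):=(x_1\wedge y_1,x_2\vee y_2)$, $\neg(x_1,x_2):=(\neg x_1,\neg x_2)$, $!(x_1,x_2):=(\rho(x_2),1)$, $\bot:=(0,0)$, with $\top:=\neg\bot$ and $x\vee y:=\neg(\neg x\wedge\neg y)$; its lattice bounds are $(0,1)$ (bottom) and $(1,0)$ (top). A DFf-twist-algebra over $\mathbf{D}_1$ and $\mathbf{D}_2$ is any subalgebra $\mathbf{C}\leqslant\mathbf{D}_1\bowtie\mathbf{D}_2$ such that $\pi_1[C]=D_1$, where $\pi_1$ is the first projection. *)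

theory Defs
  imports "HOL-Algebra.Congruence"
begin

record 'a de_morgan_alg = "'a partial_object" +
  meet :: "'a \<Rightarrow> 'a \<Rightarrow> 'a" (infixl "\<sqinter>\<index>" 70)
  join :: "'a \<Rightarrow> 'a \<Rightarrow> 'a" (infixl "\<squnion>\<index>" 65)
  neg :: "'a \<Rightarrow> 'a"
  zero :: 'a ("\<zero>\<index>")
  one :: 'a ("\<one>\<index>")

locale de_morgan_algebra =
  fixes D :: "('a, 'm) de_morgan_alg_scheme" (structure)
  assumes meet_closed: "\<lbrakk>a \<in> carrier D; b \<in> carrier D\<rbrakk> \<Longrightarrow> a \<sqinter> b \<in> carrier D"
    and join_closed: "\<lbrakk>a \<in> carrier D; b \<in> carrier D\<rbrakk> \<Longrightarrow> a \<squnion> b \<in> carrier D"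
    and neg_closed: "a \<in> carrier D \<Longrightarrow> neg D a \<in> carrier D"
    and zero_closed: "\<zero> \<in> carrier D"
    and one_closed: "\<one> \<in> carrier D"
    and meet_assoc: "\<lbrakk>a \<in> carrier D; b \<in> carrier D; c \<in> carrier D\<rbrakk>
      \<Longrightarrow> (a \<sqinter> b) \<sqinter> c = a \<sqinter> (b \<sqinter> c)"
    and join_assoc: "\<lbrakk>a \<in> carrier D; b \<in> carrier D; c \<in> carrier D\<rbrakk>
      \<Longrightarrow> (a \<squnion> b) \<squnion> c = a \<squnion> (b \<squnion> c)"
    and meet_comm: "\<lbrakk>a \<in> carrier D; b \<in> carrier D\<rbrakk> \<Longrightarrow> a \<sqinter> b = b \<sqinter> a"
    and join_comm: "\<lbrakk>a \<in> carrier D; b \<in> carrier D\<rbrakk> \<Longrightarrow> a \<squnion> b = b \<squnion> a"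
    and meet_join_absorb: "\<lbrakk>a \<in> carrier D; b \<in> carrier D\<rbrakk> \<Longrightarrow> a \<sqinter> (a \<squnion> b) = a"
    and join_meet_absorb: "\<lbrakk>a \<in> carrier D; b \<in> carrier D\<rbrakk> \<Longrightarrow> a \<squnion> (a \<sqinter> b) = a"
    and meet_join_distrib: "\<lbrakk>a \<in> carrier D; b \<in> carrier D; c \<in> carrier D\<rbrakk>
      \<Longrightarrow> a \<sqinter> (b \<squnion> c) = (a \<sqinter> b) \<squnion> (a \<sqinter> c)"
    and join_zero: "a \<in> carrier D \<Longrightarrow> a \<squnion> \<zero> = a"
    and meet_one: "a \<in> carrier D \<Longrightarrow> a \<sqinter> \<one> = a"
    and neg_neg: "a \<in> carrier D \<Longrightarrow> neg D (neg D a) = a"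
    and neg_meet: "\<lbrakk>a \<in> carrier D; b \<in> carrier D\<rbrakk>
      \<Longrightarrow> neg D (a \<sqinter> b) = neg D a \<squnion> neg D b"

definition de_morgan_hom ::
  "('a, 'm) de_morgan_alg_scheme \<Rightarrow> ('b, 'n) de_morgan_alg_scheme \<Rightarrow> ('a \<Rightarrow> 'b) \<Rightarrow> bool" where
  "de_morgan_hom A B f \<longleftrightarrow>
     (\<forall>x\<in>carrier A. f x \<in> carrier B) \<and>
     (\<forall>x\<in>carrier A. \<forall>y\<in>carrier A. f (x \<sqinter>\<^bsub>A\<^esub> y) = f x \<sqinter>\<^bsub>B\<^esub> f y) \<and>
     (\<forall>x\<in>carrier A. \<forall>y\<in>carrier A. f (x \<squnion>\<^bsub>A\<^esub> y) = f x \<squnion>\<^bsub>B\<^esub> f y) \<and>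
     (\<forall>x\<in>carrier A. f (neg A x) = neg B (f x)) \<and>
     f \<zero>\<^bsub>A\<^esub> = \<zero>\<^bsub>B\<^esub> \<and> f \<one>\<^bsub>A\<^esub> = \<one>\<^bsub>B\<^esub>"

definition de_morgan_embedding ::
  "('a, 'm) de_morgan_alg_scheme \<Rightarrow> ('b, 'n) de_morgan_alg_scheme \<Rightarrow> ('a \<Rightarrow> 'b) \<Rightarrow> bool" where
  "de_morgan_embedding A B f \<longleftrightarrow> de_morgan_hom A B f \<and> inj_on f (carrier A)"

text \<open>The constant \<open>top\<close> is not the greatest element of the lattice reduct, which is \<open>one\<close>;
  likewise \<open>bot\<close> below is not the least element, which is \<open>zero\<close>.\<close>

record 'a dff_alg = "'a de_morgan_alg" +
  bang :: "'a \<Rightarrow> 'a"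
  top :: 'a ("\<top>\<index>")

definition bot :: "('a, 'm) dff_alg_scheme \<Rightarrow> 'a" ("\<bottom>\<index>") where
  "\<bottom>\<^bsub>D\<^esub> = neg D \<top>\<^bsub>D\<^esub>"

definition dia :: "('a, 'm) dff_alg_scheme \<Rightarrow> 'a \<Rightarrow> 'a" ("\<diamond>\<index> _" [81] 80) where
  "\<diamond>\<^bsub>D\<^esub> x = x \<squnion>\<^bsub>D\<^esub> \<bottom>\<^bsub>D\<^esub>"

definition box :: "('a, 'm) dff_alg_scheme \<Rightarrow> 'a \<Rightarrow> 'a" ("\<box>\<index> _" [81] 80) where
  "\<box>\<^bsub>D\<^esub> x = x \<sqinter>\<^bsub>D\<^esub> \<bottom>\<^bsub>D\<^esub>"

locale dff_algebra = de_morgan_algebra D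
  for D :: "('a, 'm) dff_alg_scheme" (structure) +
  assumes bang_closed: "a \<in> carrier D \<Longrightarrow> bang D a \<in> carrier D"
    and top_closed: "\<top> \<in> carrier D"
    and top_eq_one_trivial: "\<lbrakk>\<top> = \<one>; x \<in> carrier D; y \<in> carrier D\<rbrakk> \<Longrightarrow> x = y"
    and top_meet_neg_top: "\<top> \<sqinter> neg D \<top> = \<zero>"
    and box_eq_imp_dia_bang_eq: "\<lbrakk>a \<in> carrier D; b \<in> carrier D; \<box> a = \<box> b\<rbrakk>
      \<Longrightarrow> \<diamond> (bang D a) = \<diamond> (bang D b)"
    and dia_box_eq_imp_eq: "\<lbrakk>a \<in> carrier D; b \<in> carrier D; \<diamond> a = \<diamond> b; \<box> a = \<box> b\<rbrakk>
      \<Longrightarrow> a = b"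
    and dia_bang_eq_imp_box_eq: "\<lbrakk>a \<in> carrier D; b \<in> carrier D;
      \<diamond> (bang D a) = \<diamond> (bang D b)\<rbrakk> \<Longrightarrow> \<box> a = \<box> b"
    and dia_bang_join: "\<lbrakk>a \<in> carrier D; b \<in> carrier D\<rbrakk>
      \<Longrightarrow> \<diamond> (bang D (a \<squnion> b)) = \<diamond> (bang D a) \<sqinter> \<diamond> (bang D b)"
    and dia_bang_neg: "a \<in> carrier D
      \<Longrightarrow> \<diamond> (bang D (neg D a)) = \<diamond> (neg D (bang D a))"
    and bang_bot: "bang D \<bottom> = \<zero>"
    and bang_zero: "bang D \<zero> = \<top>"
    and box_bang: "a \<in> carrier D \<Longrightarrow> \<box> (bang D a) = \<zero>"

text \<open>Operations prescribed on representatives (such as \<open>neg (\<diamond> a) = \<diamond> (neg a)\<close>) are rendered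
  with a definite description; that they are well defined is shown in the lemmas below.\<close>

definition dia_alg :: "('a, 'm) dff_alg_scheme \<Rightarrow> 'a de_morgan_alg" where
  "dia_alg D =
     \<lparr>carrier = dia D ` carrier D,
      meet = meet D,
      join = join D,
      neg = (\<lambda>x. THE z. \<exists>a\<in>carrier D. x = \<diamond>\<^bsub>D\<^esub> a \<and> z = \<diamond>\<^bsub>D\<^esub> (neg D a)),
      zero = \<bottom>\<^bsub>D\<^esub>,
      one = \<one>\<^bsub>D\<^esub>\<rparr>"

definition box_alg :: "('a, 'm) dff_alg_scheme \<Rightarrow> 'a de_morgan_alg" where
  "box_alg D =
     \<lparr>carrier = box D ` carrier D,
      meet = (\<lambda>x y. THE z. \<exists>a\<in>carrier D. \<exists>b\<in>carrier D.
                x = \<box>\<^bsub>D\<^esub> a \<and> y = \<box>\<^bsub>D\<^esub> b \<and> z = \<box>\<^bsub>D\<^esub> (a \<squnion>\<^bsub>D\<^esub> b)),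
      join = (\<lambda>x y. THE z. \<exists>a\<in>carrier D. \<exists>b\<in>carrier D.
                x = \<box>\<^bsub>D\<^esub> a \<and> y = \<box>\<^bsub>D\<^esub> b \<and> z = \<box>\<^bsub>D\<^esub> (a \<sqinter>\<^bsub>D\<^esub> b)),
      neg = (\<lambda>x. THE z. \<exists>a\<in>carrier D. x = \<box>\<^bsub>D\<^esub> a \<and> z = \<box>\<^bsub>D\<^esub> (neg D a)),
      zero = \<bottom>\<^bsub>D\<^esub>,
      one = \<zero>\<^bsub>D\<^esub>\<rparr>"

definition rho :: "('a, 'm) dff_alg_scheme \<Rightarrow> 'a \<Rightarrow> 'a" where
  "rho D x = (THE z. \<exists>a\<in>carrier D. x = \<box>\<^bsub>D\<^esub> a \<and> z = \<diamond>\<^bsub>D\<^esub> (bang D a))"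

definition iota :: "('a, 'm) dff_alg_scheme \<Rightarrow> 'a \<Rightarrow> 'a \<times> 'a" where
  "iota D a = (\<diamond>\<^bsub>D\<^esub> a, \<box>\<^bsub>D\<^esub> a)"

definition dff_iso ::
  "('a, 'm) dff_alg_scheme \<Rightarrow> ('b, 'n) dff_alg_scheme \<Rightarrow> ('a \<Rightarrow> 'b) \<Rightarrow> bool" where
  "dff_iso A B f \<longleftrightarrow>
     de_morgan_hom A B f \<and>
     (\<forall>x\<in>carrier A. f (bang A x) = bang B (f x)) \<and>
     f \<top>\<^bsub>A\<^esub> = \<top>\<^bsub>B\<^esub> \<and>
     bij_betw f (carrier A) (carrier B)"

definition dff_subalgebra ::
  "('a, 'm) dff_alg_scheme \<Rightarrow> ('a, 'm) dff_alg_scheme \<Rightarrow> bool" where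
  "dff_subalgebra C A \<longleftrightarrow>
     C = A\<lparr>carrier := carrier C\<rparr> \<and>
     carrier C \<subseteq> carrier A \<and>
     (\<forall>x\<in>carrier C. \<forall>y\<in>carrier C. x \<sqinter>\<^bsub>A\<^esub> y \<in> carrier C \<and> x \<squnion>\<^bsub>A\<^esub> y \<in> carrier C) \<and>
     (\<forall>x\<in>carrier C. neg A x \<in> carrier C \<and> bang A x \<in> carrier C) \<and>
     \<zero>\<^bsub>A\<^esub> \<in> carrier C \<and> \<one>\<^bsub>A\<^esub> \<in> carrier C \<and> \<top>\<^bsub>A\<^esub> \<in> carrier C"

definition twist_meet ::
  "('a, 'm) de_morgan_alg_scheme \<Rightarrow> ('b, 'n) de_morgan_alg_scheme
    \<Rightarrow> 'a \<times> 'b \<Rightarrow> 'a \<times> 'b \<Rightarrow> 'a \<times> 'b" where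
  "twist_meet D1 D2 x y = (fst x \<sqinter>\<^bsub>D1\<^esub> fst y, snd x \<squnion>\<^bsub>D2\<^esub> snd y)"

definition twist_neg ::
  "('a, 'm) de_morgan_alg_scheme \<Rightarrow> ('b, 'n) de_morgan_alg_scheme
    \<Rightarrow> 'a \<times> 'b \<Rightarrow> 'a \<times> 'b" where
  "twist_neg D1 D2 x = (neg D1 (fst x), neg D2 (snd x))"

definition full_twist ::
  "('a, 'm) de_morgan_alg_scheme \<Rightarrow> ('b, 'n) de_morgan_alg_scheme \<Rightarrow> ('b \<Rightarrow> 'a)
    \<Rightarrow> ('a \<times> 'b) dff_alg" where
  "full_twist D1 D2 \<rho> =
     \<lparr>carrier = carrier D1 \<times> carrier D2,
      meet = twist_meet D1 D2,
      join = (\<lambda>x y. twist_neg D1 D2 (twist_meet D1 D2 (twist_neg D1 D2 x) (twist_neg D1 D2 y))),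
      neg = twist_neg D1 D2,
      zero = (\<zero>\<^bsub>D1\<^esub>, \<one>\<^bsub>D2\<^esub>),
      one = (\<one>\<^bsub>D1\<^esub>, \<zero>\<^bsub>D2\<^esub>),
      bang = (\<lambda>x. (\<rho> (snd x), \<one>\<^bsub>D2\<^esub>)),
      top = twist_neg D1 D2 (\<zero>\<^bsub>D1\<^esub>, \<zero>\<^bsub>D2\<^esub>)\<rparr>"

definition dff_twist_algebra ::
  "('a, 'm) de_morgan_alg_scheme \<Rightarrow> ('b, 'n) de_morgan_alg_scheme \<Rightarrow> ('b \<Rightarrow> 'a)
    \<Rightarrow> ('a \<times> 'b) dff_alg \<Rightarrow> bool" where
  "dff_twist_algebra D1 D2 \<rho> C \<longleftrightarrow>
     de_morgan_algebra D1 \<and> de_morgan_algebra D2 \<and> de_morgan_embedding D2 D1 \<rho> \<and>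
     dff_subalgebra C (full_twist D1 D2 \<rho>) \<and>
     fst ` carrier C = carrier D1"

context dff_algebra
begin

lemma bot_closed: "\<bottom> \<in> carrier D"
  by (simp add: bot_def neg_closed top_closed)

lemma neg_join:
  assumes "a \<in> carrier D" "b \<in> carrier D"
  shows "neg D (a \<squnion> b) = neg D a \<sqinter> neg D b"
proof -
  have "neg D (neg D a \<sqinter> neg D b) = a \<squnion> b"
    using assms by (simp add: neg_meet neg_closed neg_neg)
  then have "neg D (a \<squnion> b) = neg D (neg D (neg D a \<sqinter> neg D b))"
    by simp
  then show ?thesis
    using assms by (simp add: neg_neg neg_closed meet_closed)
qed

lemma join_meet_distrib:
  assumes a: "a \<in> carrier D" and b: "b \<in> carrier D" and c: "c \<in> carrier D"
  shows "(a \<sqinter> b) \<squnion> c = (a \<squnion> c) \<sqinter> (b \<squnion> c)"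
proof -
  have "neg D ((a \<sqinter> b) \<squnion> c) = neg D c \<sqinter> (neg D a \<squnion> neg D b)"
    using meet_comm[of "neg D a \<squnion> neg D b" "neg D c"] assms
    by (simp add: neg_join neg_meet meet_closed join_closed neg_closed)
  also have "\<dots> = (neg D c \<sqinter> neg D a) \<squnion> (neg D c \<sqinter> neg D b)"
    using assms by (simp add: meet_join_distrib neg_closed)
  also have "\<dots> = (neg D a \<sqinter> neg D c) \<squnion> (neg D b \<sqinter> neg D c)"
    using meet_comm[OF neg_closed[OF c] neg_closed[OF a]]
      meet_comm[OF neg_closed[OF c] neg_closed[OF b]] by simp
  also have "\<dots> = neg D ((a \<squnion> c) \<sqinter> (b \<squnion> c))"
    using assms by (simp add: neg_join neg_meet join_closed)
  finally have "neg D (neg D ((a \<sqinter> b) \<squnion> c)) = neg D (neg D ((a \<squnion> c) \<sqinter> (b \<squnion> c)))"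
    by simp
  then show ?thesis
    using assms by (simp add: neg_neg meet_closed join_closed)
qed

lemma neg_zero: "neg D \<zero> = \<one>"
proof -
  have "neg D (\<zero> \<squnion> neg D \<one>) = neg D \<zero> \<sqinter> \<one>"
    by (simp add: neg_join zero_closed one_closed neg_closed neg_neg)
  moreover have "\<zero> \<squnion> neg D \<one> = neg D \<one>"
    using join_comm[of \<zero> "neg D \<one>"] by (simp add: join_zero neg_closed one_closed zero_closed)
  ultimately show ?thesis
    by (simp add: meet_one neg_closed zero_closed neg_neg one_closed)
qed

lemma top_join_bot: "\<top> \<squnion> \<bottom> = \<one>"
proof -
  have "neg D (\<top> \<sqinter> neg D \<top>) = \<bottom> \<squnion> \<top>"
    by (simp add: neg_meet top_closed neg_closed neg_neg bot_def)
  then show ?thesis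
    using join_comm[OF top_closed bot_closed] by (simp add: top_meet_neg_top neg_zero)
qed

lemma dia_neg: "a \<in> carrier D \<Longrightarrow> \<diamond> (neg D a) = \<diamond> (neg D (\<diamond> a))"
proof -
  assume a: "a \<in> carrier D"
  have "\<diamond> (neg D (\<diamond> a)) = (neg D a \<sqinter> \<top>) \<squnion> \<bottom>"
    unfolding dia_def neg_join[OF a bot_closed] by (simp add: bot_def neg_neg top_closed)
  also have "\<dots> = (neg D a \<squnion> \<bottom>) \<sqinter> \<one>"
    using a by (simp add: join_meet_distrib neg_closed top_closed bot_closed top_join_bot)
  finally show ?thesis
    using a by (simp add: dia_def meet_one join_closed neg_closed bot_closed)
qed

lemma box_neg: "a \<in> carrier D \<Longrightarrow> \<box> (neg D a) = \<box> (neg D (\<box> a))"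
proof -
  assume a: "a \<in> carrier D"
  have "\<box> (neg D (\<box> a)) = (neg D a \<squnion> \<top>) \<sqinter> \<bottom>"
    unfolding box_def neg_meet[OF a bot_closed] by (simp add: bot_def neg_neg top_closed)
  also have "\<dots> = \<bottom> \<sqinter> (neg D a \<squnion> \<top>)"
    using a by (intro meet_comm join_closed neg_closed top_closed bot_closed)
  also have "\<dots> = (\<bottom> \<sqinter> neg D a) \<squnion> (\<bottom> \<sqinter> \<top>)"
    using a by (intro meet_join_distrib bot_closed neg_closed top_closed)
  also have "\<bottom> \<sqinter> \<top> = \<zero>"
    using meet_comm[OF bot_closed top_closed] top_meet_neg_top by (simp add: bot_def)
  also have "(\<bottom> \<sqinter> neg D a) \<squnion> \<zero> = \<bottom> \<sqinter> neg D a"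
    using a by (intro join_zero meet_closed bot_closed neg_closed)
  also have "\<dots> = \<box> (neg D a)"
    unfolding box_def using a by (intro meet_comm bot_closed neg_closed)
  finally show ?thesis by simp
qed

lemma box_join:
  assumes a: "a \<in> carrier D" and b: "b \<in> carrier D"
  shows "\<box> (a \<squnion> b) = \<box> a \<squnion> \<box> b"
  using meet_join_distrib[OF bot_closed a b] meet_comm[OF bot_closed a] meet_comm[OF bot_closed b]
    meet_comm[OF bot_closed join_closed[OF a b]]
  by (simp add: box_def)

lemma box_meet:
  assumes a: "a \<in> carrier D" and b: "b \<in> carrier D"
  shows "\<box> (a \<sqinter> b) = \<box> a \<sqinter> \<box> b"
proof -
  have idem: "\<bottom> \<sqinter> \<bottom> = \<bottom>"
    using meet_join_absorb[OF bot_closed zero_closed] by (simp add: join_zero bot_closed)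
  have "\<box> a \<sqinter> \<box> b = a \<sqinter> (\<bottom> \<sqinter> (b \<sqinter> \<bottom>))"
    unfolding box_def using assms by (intro meet_assoc meet_closed bot_closed)
  also have "\<bottom> \<sqinter> (b \<sqinter> \<bottom>) = (b \<sqinter> \<bottom>) \<sqinter> \<bottom>"
    using assms by (intro meet_comm meet_closed bot_closed)
  also have "\<dots> = b \<sqinter> \<bottom>"
    using meet_assoc[OF b bot_closed bot_closed] by (simp add: idem)
  also have "a \<sqinter> (b \<sqinter> \<bottom>) = \<box> (a \<sqinter> b)"
    unfolding box_def using meet_assoc[OF a b bot_closed] by simp
  finally show ?thesis by simp
qed

lemma dia_alg_neg:
  assumes "a \<in> carrier D"
  shows "neg (dia_alg D) (\<diamond> a) = \<diamond> (neg D a)"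
proof -
  have "(THE z. \<exists>b\<in>carrier D. \<diamond> a = \<diamond> b \<and> z = \<diamond> (neg D b)) = \<diamond> (neg D a)"
  proof (rule the_equality)
    fix z assume "\<exists>b\<in>carrier D. \<diamond> a = \<diamond> b \<and> z = \<diamond> (neg D b)"
    then obtain b where "b \<in> carrier D" "\<diamond> a = \<diamond> b" "z = \<diamond> (neg D b)" by blast
    then show "z = \<diamond> (neg D a)"
      using dia_neg[of b] dia_neg[OF assms] by simp
  qed (use assms in blast)
  then show ?thesis by (simp add: dia_alg_def)
qed

lemma box_alg_neg:
  assumes "a \<in> carrier D"
  shows "neg (box_alg D) (\<box> a) = \<box> (neg D a)"
proof -
  have "(THE z. \<exists>b\<in>carrier D. \<box> a = \<box> b \<and> z = \<box> (neg D b)) = \<box> (neg D a)"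
  proof (rule the_equality)
    fix z assume "\<exists>b\<in>carrier D. \<box> a = \<box> b \<and> z = \<box> (neg D b)"
    then obtain b where "b \<in> carrier D" "\<box> a = \<box> b" "z = \<box> (neg D b)" by blast
    then show "z = \<box> (neg D a)"
      using box_neg[of b] box_neg[OF assms] by simp
  qed (use assms in blast)
  then show ?thesis by (simp add: box_alg_def)
qed

lemma box_alg_meet:
  assumes "a \<in> carrier D" "b \<in> carrier D"
  shows "meet (box_alg D) (\<box> a) (\<box> b) = \<box> (a \<squnion> b)"
proof -
  have "(THE z. \<exists>c\<in>carrier D. \<exists>d\<in>carrier D. \<box> a = \<box> c \<and> \<box> b = \<box> d \<and> z = \<box> (c \<squnion> d))
      = \<box> (a \<squnion> b)"
  proof (rule the_equality)
    fix z assume "\<exists>c\<in>carrier D. \<exists>d\<in>carrier D. \<box> a = \<box> c \<and> \<box> b = \<box> d \<and> z = \<box> (c \<squnion> d)"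
    then obtain c d where "c \<in> carrier D" "d \<in> carrier D" "\<box> a = \<box> c" "\<box> b = \<box> d"
      "z = \<box> (c \<squnion> d)" by blast
    then show "z = \<box> (a \<squnion> b)"
      using box_join[of c d] box_join[OF assms] by simp
  qed (use assms in blast)
  then show ?thesis by (simp add: box_alg_def)
qed

lemma box_alg_join:
  assumes "a \<in> carrier D" "b \<in> carrier D"
  shows "join (box_alg D) (\<box> a) (\<box> b) = \<box> (a \<sqinter> b)"
proof -
  have "(THE z. \<exists>c\<in>carrier D. \<exists>d\<in>carrier D. \<box> a = \<box> c \<and> \<box> b = \<box> d \<and> z = \<box> (c \<sqinter> d))
      = \<box> (a \<sqinter> b)"
  proof (rule the_equality)
    fix z assume "\<exists>c\<in>carrier D. \<exists>d\<in>carrier D. \<box> a = \<box> c \<and> \<box> b = \<box> d \<and> z = \<box> (c \<sqinter> d)"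
    then obtain c d where "c \<in> carrier D" "d \<in> carrier D" "\<box> a = \<box> c" "\<box> b = \<box> d"
      "z = \<box> (c \<sqinter> d)" by blast
    then show "z = \<box> (a \<sqinter> b)"
      using box_meet[of c d] box_meet[OF assms] by simp
  qed (use assms in blast)
  then show ?thesis by (simp add: box_alg_def)
qed

lemma rho_box:
  assumes "a \<in> carrier D"
  shows "rho D (\<box> a) = \<diamond> (bang D a)"
  unfolding rho_def
proof (rule the_equality)
  fix z assume "\<exists>b\<in>carrier D. \<box> a = \<box> b \<and> z = \<diamond> (bang D b)"
  then obtain b where "b \<in> carrier D" "\<box> a = \<box> b" "z = \<diamond> (bang D b)" by blast
  then show "z = \<diamond> (bang D a)"
    using box_eq_imp_dia_bang_eq[OF assms, of b] by simp
qed (use assms in blast)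

end

end

theory Submission
  imports Defs
begin

text \<open>
  Every operation of the twist product acts on pairs \<open>(\<diamond> a, \<box> a)\<close> by the formula that
  describes how \<open>\<diamond>\<close> and \<open>\<box>\<close> behave under the corresponding operation of \<open>D\<close>. On the one
  hand \<open>\<diamond>\<close> is a homomorphism from \<open>D\<close> onto \<open>\<diamond>(D)\<close>. On the other hand the lattice operations of
  \<open>\<box>(D)\<close> are turned upside down, so \<open>a \<mapsto> \<box> (\<not> a)\<close> is a homomorphism from \<open>D\<close> onto \<open>\<box>(D)\<close>.
  Since the De Morgan axioms are equations, they pass to homomorphic images
  (\<open>de_morgan_algebra_hom_image\<close>), which makes \<open>\<diamond>(D)\<close> and \<open>\<box>(D)\<close> De Morgan algebras.

  The map \<open>\<rho>\<close> is injective because \<open>\<diamond> ! a\<close> determines \<open>\<box> a\<close>. Further axioms on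
  \<open>!\<close> give that \<open>\<rho>\<close> respects meets, negations and bounds; joins follow by De Morgan duality
  (\<open>de_morgan_hom_if_meet_neg\<close>).

  Finally \<open>\<iota>\<close> preserves \<open>!\<close> because \<open>\<rho> (\<box> a) = \<diamond> ! a\<close> and \<open>\<box> ! a\<close> is the constant \<open>\<zero>\<close>, the
  greatest element of \<open>\<box>(D)\<close>. It is injective because \<open>\<diamond> a\<close> and \<open>\<box> a\<close> together determine \<open>a\<close>.
  Hence \<open>D\<close> is isomorphic to the image of \<open>\<iota>\<close>, which is a subalgebra of the full twist algebra
  with first projection \<open>\<diamond>[D]\<close>.
\<close>

section \<open>Homomorphisms of De Morgan algebras\<close>

context de_morgan_algebra
begin

lemma neg_meet_neg:
  assumes "a \<in> carrier D" "b \<in> carrier D"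
  shows "neg D (neg D a \<sqinter> neg D b) = a \<squnion> b"
  using assms by (simp add: neg_meet neg_closed neg_neg)

text \<open>Apart from closure, all axioms are equations, so each one holds for \<open>f a, f b, f c\<close>
  because it holds for \<open>a, b, c\<close>.\<close>

lemma de_morgan_algebra_hom_image:
  assumes hom: "de_morgan_hom D B f" and onto: "f ` carrier D = carrier B"
  shows "de_morgan_algebra B"
proof -
  note h = hom[unfolded de_morgan_hom_def]
  have m: "f a \<sqinter>\<^bsub>B\<^esub> f b = f (a \<sqinter> b)" if "a \<in> carrier D" "b \<in> carrier D" for a b
    using h that by simp
  have j: "f a \<squnion>\<^bsub>B\<^esub> f b = f (a \<squnion> b)" if "a \<in> carrier D" "b \<in> carrier D" for a b
    using h that by simp
  have n: "neg B (f a) = f (neg D a)" if "a \<in> carrier D" for a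
    using h that by simp
  have z: "\<zero>\<^bsub>B\<^esub> = f \<zero>" and u: "\<one>\<^bsub>B\<^esub> = f \<one>"
    using h by simp_all
  show ?thesis
    \<comment> \<open>Commutativity is only a closing step: rewriting with it as well would not terminate.\<close>
    by (unfold_locales; unfold onto[symmetric]; (elim imageE)?;
        simp add: m j n z u meet_closed join_closed neg_closed zero_closed one_closed
          meet_assoc join_assoc meet_join_absorb join_meet_absorb meet_join_distrib
          join_zero meet_one neg_neg neg_meet;
        intro arg_cong[where f = f] meet_comm join_comm; assumption)
qed

text \<open>Joins are definable from meets and negations. This is what gives the join law for \<open>\<rho>\<close>, as
  the axioms on \<open>!\<close> speak about \<open>! (a \<squnion> b)\<close> but not about \<open>! (a \<sqinter> b)\<close>.\<close>

lemma de_morgan_hom_if_meet_neg: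
  assumes B: "de_morgan_algebra B"
    and closed: "\<And>x. x \<in> carrier D \<Longrightarrow> f x \<in> carrier B"
    and meet: "\<And>x y. x \<in> carrier D \<Longrightarrow> y \<in> carrier D \<Longrightarrow> f (x \<sqinter> y) = f x \<sqinter>\<^bsub>B\<^esub> f y"
    and neg: "\<And>x. x \<in> carrier D \<Longrightarrow> f (neg D x) = neg B (f x)"
    and zero: "f \<zero> = \<zero>\<^bsub>B\<^esub>" and one: "f \<one> = \<one>\<^bsub>B\<^esub>"
  shows "de_morgan_hom D B f"
proof -
  interpret B: de_morgan_algebra B by (rule B)
  have "f (x \<squnion> y) = f x \<squnion>\<^bsub>B\<^esub> f y" if x: "x \<in> carrier D" and y: "y \<in> carrier D" for x y
  proof -
    have "f (x \<squnion> y) = f (neg D (neg D x \<sqinter> neg D y))"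
      using x y by (simp add: neg_meet_neg)
    also have "\<dots> = neg B (neg B (f x) \<sqinter>\<^bsub>B\<^esub> neg B (f y))"
      using x y by (simp add: neg meet meet_closed neg_closed)
    also have "\<dots> = f x \<squnion>\<^bsub>B\<^esub> f y"
      using x y by (simp add: B.neg_meet_neg closed)
    finally show ?thesis .
  qed
  then show ?thesis
    using assms by (simp add: de_morgan_hom_def)
qed

end

section \<open>The two factors and the embedding between them\<close>

context dff_algebra
begin

lemma dia_meet:
  assumes "a \<in> carrier D" "b \<in> carrier D"
  shows "\<diamond> (a \<sqinter> b) = \<diamond> a \<sqinter> \<diamond> b"
  using assms by (simp add: dia_def join_meet_distrib bot_closed)

lemma neg_one: "neg D \<one> = \<zero>"
  using neg_neg[OF zero_closed] by (simp add: neg_zero)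

lemma bot_join_bot: "\<bottom> \<squnion> \<bottom> = \<bottom>"
  using join_meet_absorb[OF bot_closed one_closed] by (simp add: meet_one bot_closed)

lemma dia_join:
  assumes a: "a \<in> carrier D" and b: "b \<in> carrier D"
  shows "\<diamond> (a \<squnion> b) = \<diamond> a \<squnion> \<diamond> b"
proof -
  have "\<diamond> a \<squnion> \<diamond> b = a \<squnion> (\<bottom> \<squnion> (b \<squnion> \<bottom>))"
    unfolding dia_def using a b by (intro join_assoc join_closed bot_closed)
  also have "\<bottom> \<squnion> (b \<squnion> \<bottom>) = (b \<squnion> \<bottom>) \<squnion> \<bottom>"
    using b by (intro join_comm join_closed bot_closed)
  also have "\<dots> = b \<squnion> \<bottom>"
    using join_assoc[OF b bot_closed bot_closed] by (simp add: bot_join_bot)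
  also have "a \<squnion> (b \<squnion> \<bottom>) = \<diamond> (a \<squnion> b)"
    unfolding dia_def using join_assoc[OF a b bot_closed] by simp
  finally show ?thesis by simp
qed

lemma dia_zero: "\<diamond> \<zero> = \<bottom>"
  using join_comm[OF zero_closed bot_closed] by (simp add: dia_def join_zero bot_closed)

lemma dia_one: "\<diamond> \<one> = \<one>"
proof -
  have "\<one> \<squnion> \<bottom> = \<one> \<squnion> (\<one> \<sqinter> \<bottom>)"
    using meet_comm[OF one_closed bot_closed] by (simp add: meet_one bot_closed)
  then show ?thesis
    by (simp add: dia_def join_meet_absorb one_closed bot_closed)
qed

lemma dia_bot: "\<diamond> \<bottom> = \<bottom>"
  by (simp add: dia_def bot_join_bot)

lemma dia_top: "\<diamond> \<top> = \<one>"
  by (simp add: dia_def top_join_bot)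

lemma box_one: "\<box> \<one> = \<bottom>"
  using meet_comm[OF one_closed bot_closed] by (simp add: box_def meet_one bot_closed)

lemma box_zero: "\<box> \<zero> = \<zero>"
proof -
  have "\<zero> \<sqinter> \<bottom> = \<zero> \<sqinter> (\<zero> \<squnion> \<bottom>)"
    using dia_zero by (simp add: dia_def)
  then show ?thesis
    by (simp add: box_def meet_join_absorb zero_closed bot_closed)
qed

lemma box_bot: "\<box> \<bottom> = \<bottom>"
  using meet_join_absorb[OF bot_closed bot_closed] by (simp add: box_def bot_join_bot)

lemma dia_alg_simps:
  "carrier (dia_alg D) = dia D ` carrier D" "x \<sqinter>\<^bsub>dia_alg D\<^esub> y = x \<sqinter> y"
  "x \<squnion>\<^bsub>dia_alg D\<^esub> y = x \<squnion> y" "\<zero>\<^bsub>dia_alg D\<^esub> = \<bottom>" "\<one>\<^bsub>dia_alg D\<^esub> = \<one>"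
  by (simp_all add: dia_alg_def)

lemma box_alg_simps:
  "carrier (box_alg D) = box D ` carrier D" "\<zero>\<^bsub>box_alg D\<^esub> = \<bottom>" "\<one>\<^bsub>box_alg D\<^esub> = \<zero>"
  by (simp_all add: box_alg_def)

lemma dia_hom: "de_morgan_hom D (dia_alg D) (dia D)"
  by (simp add: de_morgan_hom_def dia_alg_simps dia_meet dia_join dia_alg_neg dia_zero dia_one)

lemma dia_alg_de_morgan: "de_morgan_algebra (dia_alg D)"
  by (rule de_morgan_algebra_hom_image[OF dia_hom]) (simp add: dia_alg_simps)

text \<open>Composing \<open>\<box>\<close> with the negation of \<open>D\<close> compensates for the reversed order of \<open>\<box>(D)\<close>.\<close>

lemma box_neg_hom: "de_morgan_hom D (box_alg D) (\<lambda>a. \<box> (neg D a))"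
  by (simp add: de_morgan_hom_def box_alg_simps neg_meet neg_join box_alg_meet box_alg_join
      box_alg_neg neg_closed neg_zero neg_one box_one box_zero)

lemma box_alg_de_morgan: "de_morgan_algebra (box_alg D)"
proof (rule de_morgan_algebra_hom_image[OF box_neg_hom])
  have "neg D ` carrier D = carrier D"
    by (force simp: neg_closed neg_neg intro: rev_image_eqI[OF neg_closed])
  then show "(\<lambda>a. \<box> (neg D a)) ` carrier D = carrier (box_alg D)"
    by (metis box_alg_simps(1) image_image)
qed

lemma rho_embedding: "de_morgan_embedding (box_alg D) (dia_alg D) (rho D)"
  unfolding de_morgan_embedding_def
proof
  interpret box: de_morgan_algebra "box_alg D" by (rule box_alg_de_morgan)
  show "de_morgan_hom (box_alg D) (dia_alg D) (rho D)"
  proof (rule box.de_morgan_hom_if_meet_neg[OF dia_alg_de_morgan])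
    \<comment> \<open>The bounds of \<open>\<box>(D)\<close> are represented by \<open>\<bottom>\<close> and \<open>\<zero>\<close>, where the values of \<open>!\<close> are given.\<close>
    show "rho D \<zero>\<^bsub>box_alg D\<^esub> = \<zero>\<^bsub>dia_alg D\<^esub>"
      using rho_box[OF bot_closed]
      by (simp add: box_alg_simps dia_alg_simps box_bot bang_bot dia_zero)
    show "rho D \<one>\<^bsub>box_alg D\<^esub> = \<one>\<^bsub>dia_alg D\<^esub>"
      using rho_box[OF zero_closed]
      by (simp add: box_alg_simps dia_alg_simps box_zero bang_zero dia_top)
  qed (auto simp: box_alg_simps dia_alg_simps box_alg_meet box_alg_neg rho_box dia_alg_neg
      dia_bang_join dia_bang_neg bang_closed join_closed neg_closed)
  show "inj_on (rho D) (carrier (box_alg D))"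
    by (auto simp: inj_on_def box_alg_simps rho_box intro: dia_bang_eq_imp_box_eq)
qed

section \<open>The representation map\<close>

text \<open>The join of the twist algebra is defined from meet and negation, so its first coordinate is a
  join only by De Morgan's law in \<open>D\<close>; its second coordinate is treated in the same way.\<close>

lemma iota_hom: "de_morgan_hom D (full_twist (dia_alg D) (box_alg D) (rho D)) (iota D)"
  by (simp add: de_morgan_hom_def full_twist_def twist_meet_def twist_neg_def iota_def
      dia_alg_simps box_alg_simps dia_alg_neg box_alg_neg box_alg_join
      dia_meet[symmetric] meet_closed neg_closed neg_meet_neg
      dia_zero dia_one box_zero box_one)

lemma iota_bang:
  assumes "a \<in> carrier D"
  shows "iota D (bang D a) = bang (full_twist (dia_alg D) (box_alg D) (rho D)) (iota D a)"
  using assms by (simp add: full_twist_def iota_def rho_box box_bang box_alg_simps)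

lemma iota_top: "iota D \<top> = \<top>\<^bsub>full_twist (dia_alg D) (box_alg D) (rho D)\<^esub>"
proof -
  have neg_bot: "neg D \<bottom> = \<top>"
    by (simp add: bot_def neg_neg top_closed)
  show ?thesis
    using dia_alg_neg[OF bot_closed] box_alg_neg[OF bot_closed]
    by (simp add: full_twist_def twist_neg_def iota_def dia_alg_simps box_alg_simps
        dia_bot box_bot neg_bot)
qed

lemma inj_iota: "inj_on (iota D) (carrier D)"
  by (auto simp: inj_on_def iota_def intro: dia_box_eq_imp_eq)

text \<open>Being an isomorphism onto a subalgebra thus comes down to identities and injectivity on \<open>D\<close>:
  an operation of \<open>A\<close> sends values of \<open>f\<close> to the value of \<open>f\<close> at the corresponding result in \<open>D\<close>.\<close>

lemma image_dff_subalgebra_iso: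
  fixes A :: "'b dff_alg"
  assumes hom: "de_morgan_hom D A f"
    and bang: "\<And>a. a \<in> carrier D \<Longrightarrow> f (bang D a) = bang A (f a)"
    and top: "f \<top> = \<top>\<^bsub>A\<^esub>"
    and inj: "inj_on f (carrier D)"
  defines "C \<equiv> A\<lparr>carrier := f ` carrier D\<rparr>"
  shows "dff_subalgebra C A" and "dff_iso D C f"
proof -
  note h = hom[unfolded de_morgan_hom_def]
  have "x \<sqinter>\<^bsub>A\<^esub> y \<in> f ` carrier D \<and> x \<squnion>\<^bsub>A\<^esub> y \<in> f ` carrier D"
    if xy: "x \<in> f ` carrier D" "y \<in> f ` carrier D" for x y
  proof -
    obtain a b where "a \<in> carrier D" "b \<in> carrier D" "x = f a" "y = f b"
      using xy by blast
    then have "x \<sqinter>\<^bsub>A\<^esub> y = f (a \<sqinter> b)" "x \<squnion>\<^bsub>A\<^esub> y = f (a \<squnion> b)"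
      "a \<sqinter> b \<in> carrier D" "a \<squnion> b \<in> carrier D"
      using h by (simp_all add: meet_closed join_closed)
    then show ?thesis by simp
  qed
  moreover have "neg A x \<in> f ` carrier D \<and> bang A x \<in> f ` carrier D"
    if x: "x \<in> f ` carrier D" for x
  proof -
    obtain a where "a \<in> carrier D" "x = f a"
      using x by blast
    then have "neg A x = f (neg D a)" "bang A x = f (bang D a)"
      "neg D a \<in> carrier D" "bang D a \<in> carrier D"
      using h bang by (simp_all add: neg_closed bang_closed)
    then show ?thesis by simp
  qed
  moreover have "\<zero>\<^bsub>A\<^esub> \<in> f ` carrier D" "\<one>\<^bsub>A\<^esub> \<in> f ` carrier D" "\<top>\<^bsub>A\<^esub> \<in> f ` carrier D"
    using h imageI[OF zero_closed, of f] imageI[OF one_closed, of f] imageI[OF top_closed, of f] top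
    by simp_all
  ultimately show "dff_subalgebra C A"
    using h by (auto simp: dff_subalgebra_def C_def)
  show "dff_iso D C f"
    using h bang top inj by (simp add: dff_iso_def de_morgan_hom_def C_def bij_betw_def)
qed

end

theorem theorem72:
  fixes D :: "('a, 'm) dff_alg_scheme"
  assumes "dff_algebra D"
  shows "(\<forall>a\<in>carrier D. rho D (\<box>\<^bsub>D\<^esub> a) = \<diamond>\<^bsub>D\<^esub> (bang D a)) \<and>
    de_morgan_embedding (box_alg D) (dia_alg D) (rho D) \<and>
    (\<exists>C. dff_twist_algebra (dia_alg D) (box_alg D) (rho D) C \<and> dff_iso D C (iota D))"
proof -
  interpret dff_algebra D by (rule assms)
  let ?T = "full_twist (dia_alg D) (box_alg D) (rho D)"
  let ?C = "?T\<lparr>carrier := iota D ` carrier D\<rparr>"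
  note iota_image = image_dff_subalgebra_iso[OF iota_hom iota_bang iota_top inj_iota]
  have "fst ` carrier ?C = carrier (dia_alg D)"
    by (simp add: image_image iota_def dia_alg_simps)
  then have "dff_twist_algebra (dia_alg D) (box_alg D) (rho D) ?C"
    using dia_alg_de_morgan box_alg_de_morgan rho_embedding iota_image(1)
    by (simp add: dff_twist_algebra_def)
  then show ?thesis
    using rho_box rho_embedding iota_image(2) by blast
qed

end
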